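(* Let $G=\{1_G,\alpha,\beta,\gamma\}$ be the Klein four group acting on a finite set $X$. Let $X_1,\dots,X_s$ be the orbits of length 4, $X_{\alpha,1},\dots,X_{\alpha,p}$ the orbits of length 2 on which $\alpha$ acts trivially, $X_{\beta,1},\dots,X_{\beta,q}$ those on which $\beta$ acts trivially, $X_{\gamma,1},\dots,X_{\gamma,r}$ those on which $\gamma$ acts trivially, and $X_{01},\dots,X_{0t}$ the orbits of length 1 (any of $s,p,q,r,t$ may be 0). Then there exists a $G$-perfect nonlinear function from $X$ to $\mathbb F_2$ if and only if one of the following holds: (i) there exists a $G$-perfect nonlinear function from $X\setminus(X_1\cup\dots\cup X_s)$ to $\mathbb F_2$; or (ii) $4\mid v_0$, where $v_0=2p+2q+2r+t$, and there are nonnegative integers $k_0,p_1,q_1,r_1$ with $p_1\le p$, $q_1\le q$, $r_1\le r$, $p_1\equiv q_1\equiv r_1 \pmod 2$, $s\ge \frac{3v_0}{4}+4k_0-2(p_1+q_1+r_1)$, and $\frac{v_0}{4}+k_0\ge\max\big\{p_1+\frac{q_1+r_1}{2},\ q_1+\frac{p_1+r_1}{2},\ r_1+\frac{p_1+q_1}{2}\big\}$.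
   Context: $\mathbb F_2$ is the additive group of order 2. For a $G$-set $W$, a function $g:W\to\mathbb F_2$ is $G$-perfect nonlinear if $2$ divides $|W|$ and for every $\delta\in G\setminus\{1_G\}$ and $\sigma\in\mathbb F_2$, $|\{w\in W:g(\delta w)-g(w)=\sigma\}|=|W|/2$. *)

theory Defs
  imports
    Complex_Main
    "HOL-Algebra.Group_Action"
    "HOL-Algebra.Elementary_Groups"
    "HOL-Number_Theory.Cong"
    "HOL-Library.Z2"
begin

definition klein_four_group :: "('g, 'm) monoid_scheme \<Rightarrow> bool" where
  "klein_four_group G \<longleftrightarrow>
     group G \<and> G \<cong> (integer_mod_group 2 \<times>\<times> integer_mod_group 2)"

text \<open>
  Here \<open>W\<close> is a finite set on which \<open>G\<close> acts via \<open>\<phi>\<close>; it may also be a \<open>G\<close>-invariant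
  subset of the set on which \<open>\<phi>\<close> is an action, since \<open>\<phi>\<close> is only applied to points of \<open>W\<close>.
  The additive group \<open>\<bbbF>\<^sub>2\<close> is the type \<^typ>\<open>bit\<close>, and only the values of \<open>g\<close> on \<open>W\<close> matter.
\<close>

definition perfect_nonlinear ::
  "('g, 'm) monoid_scheme \<Rightarrow> ('g \<Rightarrow> 'x \<Rightarrow> 'x) \<Rightarrow> 'x set \<Rightarrow> ('x \<Rightarrow> bit) \<Rightarrow> bool" where
  "perfect_nonlinear G \<phi> W g \<longleftrightarrow>
     2 dvd card W \<and>
     (\<forall>\<delta> \<in> carrier G - {\<one>\<^bsub>G\<^esub>}. \<forall>\<sigma>.
        card {w \<in> W. g (\<phi> \<delta> w) - g w = \<sigma>} = card W div 2)"

definition orbits_of_length ::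
  "('g, 'm) monoid_scheme \<Rightarrow> 'x set \<Rightarrow> ('g \<Rightarrow> 'x \<Rightarrow> 'x) \<Rightarrow> nat \<Rightarrow> 'x set set" where
  "orbits_of_length G X \<phi> n = {Y \<in> orbits G X \<phi>. card Y = n}"

definition acts_trivially_on :: "('g \<Rightarrow> 'x \<Rightarrow> 'x) \<Rightarrow> 'g \<Rightarrow> 'x set \<Rightarrow> bool" where
  "acts_trivially_on \<phi> \<delta> Y \<longleftrightarrow> (\<forall>y \<in> Y. \<phi> \<delta> y = y)"

end

theory Submission
  imports Defs
begin

text \<open>
  For \<open>g : X \<rightarrow> \<bbbF>\<^sub>2\<close> and \<open>\<delta> \<noteq> 1\<close>, let \<open>D\<^sub>\<delta>\<close> be the number of points with \<open>g (\<delta> w) \<noteq> g w\<close>; then \<open>g\<close> is perfect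
  nonlinear iff \<open>2 D\<^sub>\<delta> = |X|\<close> for all three \<open>\<delta>\<close>. The numbers \<open>D\<^sub>\<delta>\<close> add up over orbits, and \<open>g\<close> may be
  prescribed on each orbit separately. On an orbit of length 4 the possible triples
  \<open>(D\<^sub>\<alpha>, D\<^sub>\<beta>, D\<^sub>\<gamma>)\<close> are \<open>(0,0,0)\<close>, \<open>(2,2,2)\<close> (\<open>g\<close> of odd weight), \<open>(0,4,4)\<close>, \<open>(4,0,4)\<close>, \<open>(4,4,0)\<close>; on an
  orbit of length 2 fixed by \<open>\<alpha>\<close> they are \<open>(0,0,0)\<close> and \<open>(0,2,2)\<close>, and similarly for \<open>\<beta>\<close>, \<open>\<gamma>\<close>.
  Let \<open>k\<^sub>0, n, a, b, c\<close> be the numbers of 4-orbits of each kind and \<open>p\<^sub>1, q\<^sub>1, r\<^sub>1\<close> the numbers of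
  2-orbits on which \<open>g\<close> is not constant. Solving the three linear equations gives
  \<open>a = v\<^sub>0/4 + k\<^sub>0 - p\<^sub>1 - (q\<^sub>1 + r\<^sub>1)/2\<close> and its analogues for \<open>b\<close> and \<open>c\<close>; that these are nonnegative
  integers with \<open>k\<^sub>0 + a + b + c \<le> s\<close> is condition (ii). Condition (i) suffices as well, because a
  function of odd weight on a 4-orbit is perfect nonlinear there.
\<close>

section \<open>Maps between finite sets with prescribed fibre sizes\<close>

text \<open>Induction on \<open>T\<close>: a subset \<open>M\<close> of size \<open>m k\<close>
  becomes the fibre of the new value \<open>k\<close>, and the induction hypothesis distributes the
  rest of \<open>S\<close>.\<close>

lemma ex_map_with_fibre_cards:
  assumes "finite T" "finite S" "(\<Sum>k\<in>T. m k) = card S"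
  shows "\<exists>f. f ` S \<subseteq> T \<and> (\<forall>k\<in>T. card {x \<in> S. f x = k} = m k)"
  using assms
proof (induction T arbitrary: S rule: finite_induct)
  case empty
  then show ?case by simp
next
  case (insert k T)
  then have "m k \<le> card S" by simp
  then obtain M where M: "M \<subseteq> S" "card M = m k"
    by (meson obtain_subset_with_card_n)
  have "(\<Sum>k\<in>T. m k) = card (S - M)"
    using insert M by (simp add: card_Diff_subset finite_subset)
  then obtain f where f: "f ` (S - M) \<subseteq> T" "\<forall>k\<in>T. card {x \<in> S - M. f x = k} = m k"
    using insert.IH[of "S - M"] insert.prems by auto
  define f' where "f' = (\<lambda>x. if x \<in> M then k else f x)"
  have "{x \<in> S. f' x = k} = M"
    using f(1) M(1) insert.hyps by (auto simp: f'_def)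
  moreover have "{x \<in> S. f' x = j} = {x \<in> S - M. f x = j}" if "j \<in> T" for j
    using that insert.hyps by (auto simp: f'_def)
  moreover have "f' ` S \<subseteq> insert k T"
    using f(1) by (auto simp: f'_def)
  ultimately show ?case
    using f(2) M(2) by (intro exI[of _ f']) auto
qed

text \<open>The quantifier over \<open>h\<close> stands inside the existential, so that one
  assignment of values serves all three coordinate sums at once.\<close>

lemma ex_map_with_fibre_sums:
  fixes m :: "'k \<Rightarrow> nat"
  assumes "finite T" "finite S" "(\<Sum>k\<in>T. m k) = card S"
  shows "\<exists>f. f ` S \<subseteq> T \<and> (\<forall>h :: 'k \<Rightarrow> nat. (\<Sum>x\<in>S. h (f x)) = (\<Sum>k\<in>T. m k * h k))"
proof -
  obtain f where f: "f ` S \<subseteq> T" "\<forall>k\<in>T. card {x \<in> S. f x = k} = m k"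
    using ex_map_with_fibre_cards[OF assms] by blast
  have "(\<Sum>x\<in>S. h (f x)) = (\<Sum>k\<in>T. m k * h k)" for h :: "'k \<Rightarrow> nat"
    using sum_fun_comp[OF assms(2,1) f(1), of h] f(2) by simp
  with f(1) show ?thesis by blast
qed

text \<open>The fibre sizes of \<open>f\<close> are the multiplicities; the constant function 1 in
  place of \<open>h\<close> yields their total.\<close>

lemma ex_fibre_sums_of_map:
  assumes "finite T" "finite S" "f ` S \<subseteq> T"
  shows "\<exists>m :: 'k \<Rightarrow> nat. (\<Sum>k\<in>T. m k) = card S \<and>
           (\<forall>h :: 'k \<Rightarrow> nat. (\<Sum>x\<in>S. h (f x)) = (\<Sum>k\<in>T. m k * h k))"
proof -
  have "(\<Sum>x\<in>S. h (f x)) = (\<Sum>k\<in>T. card {x \<in> S. f x = k} * h k)" for h :: "'k \<Rightarrow> nat"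
    using sum_fun_comp[OF assms(2,1,3), of h] by simp
  from this this[of "\<lambda>_. 1"] show ?thesis
    by (intro exI[of _ "\<lambda>k. card {x \<in> S. f x = k}"]) simp
qed

section \<open>Perfect nonlinearity through weights of derivatives\<close>

text \<open>This is the Hamming weight on \<open>W\<close> of the derivative of \<open>g\<close> in
  direction \<delta>. Being a count over points, it is additive over orbits.\<close>

definition deriv_weight :: "('g \<Rightarrow> 'x \<Rightarrow> 'x) \<Rightarrow> ('x \<Rightarrow> bit) \<Rightarrow> 'g \<Rightarrow> 'x set \<Rightarrow> nat" where
  "deriv_weight \<phi> g \<delta> W = card {w \<in> W. g (\<phi> \<delta> w) \<noteq> g w}"

lemma deriv_weight_eq_sum:
  "finite W \<Longrightarrow> deriv_weight \<phi> g \<delta> W = (\<Sum>w\<in>W. of_bool (g (\<phi> \<delta> w) \<noteq> g w))"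
  by (simp add: deriv_weight_def Int_def)

text \<open>The level sets of the derivative at 0 and 1 partition \<open>W\<close>, so for even
  \<open>card W\<close> each has half the size as soon as one of them does.\<close>

lemma perfect_nonlinear_iff_deriv_weight:
  assumes "finite W"
  shows "perfect_nonlinear G \<phi> W g \<longleftrightarrow> even (card W) \<and>
    (\<forall>\<delta> \<in> carrier G - {\<one>\<^bsub>G\<^esub>}. 2 * deriv_weight \<phi> g \<delta> W = card W)"
proof -
  have all_bit: "(\<forall>\<sigma>. P \<sigma>) \<longleftrightarrow> P 0 \<and> P 1" for P :: "bit \<Rightarrow> bool"
    by (metis (full_types) bit_not_zero_iff)
  have "(\<forall>\<sigma>. card {w \<in> W. g (\<phi> \<delta> w) - g w = \<sigma>} = card W div 2) \<longleftrightarrow>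
      2 * deriv_weight \<phi> g \<delta> W = card W" (is "?L \<longleftrightarrow> ?R") if "even (card W)" for \<delta>
  proof -
    have 1: "{w \<in> W. g (\<phi> \<delta> w) - g w = 1} = {w \<in> W. g (\<phi> \<delta> w) \<noteq> g w}"
      using bit_not_zero_iff by (metis (lifting) right_minus_eq zero_neq_one)
    have 0: "{w \<in> W. g (\<phi> \<delta> w) - g w = 0} = W - {w \<in> W. g (\<phi> \<delta> w) \<noteq> g w}"
      by auto
    have c0: "card {w \<in> W. g (\<phi> \<delta> w) - g w = 0} = card W - deriv_weight \<phi> g \<delta> W"
      unfolding 0 deriv_weight_def using assms by (simp add: card_Diff_subset)
    have c1: "card {w \<in> W. g (\<phi> \<delta> w) - g w = 1} = deriv_weight \<phi> g \<delta> W"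
      unfolding 1 deriv_weight_def ..
    have "?L \<longleftrightarrow> card {w \<in> W. g (\<phi> \<delta> w) - g w = 0} = card W div 2 \<and>
                card {w \<in> W. g (\<phi> \<delta> w) - g w = 1} = card W div 2"
      by (rule all_bit)
    also have "\<dots> \<longleftrightarrow> ?R"
      unfolding c0 c1 using that by (auto elim!: evenE)
    finally show ?thesis .
  qed
  then show ?thesis
    unfolding perfect_nonlinear_def by blast
qed

section \<open>Actions of the Klein four group and their orbits\<close>

text \<open>The assumptions are symmetric in the three involutions, so the locale can be interpreted
  again with their names permuted.\<close>

locale klein_action = group_action +
  fixes \<alpha> \<beta> \<gamma>
  assumes carrier_eq: "carrier G = {\<one>, \<alpha>, \<beta>, \<gamma>}"
    and distinct4: "distinct [\<one>, \<alpha>, \<beta>, \<gamma>]"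
    and square_eq_one: "\<delta> \<in> carrier G \<Longrightarrow> \<delta> \<otimes> \<delta> = \<one>"
    and finite_E: "finite E"
begin

text \<open>The transpositions generate all renamings of the involutions; facts proved for one
  arrangement are transferred through them.\<close>

lemma klein_swap12: "klein_action G E \<phi> \<beta> \<alpha> \<gamma>"
  by unfold_locales (use carrier_eq distinct4 square_eq_one finite_E in auto)

lemma klein_swap13: "klein_action G E \<phi> \<gamma> \<beta> \<alpha>"
  by unfold_locales (use carrier_eq distinct4 square_eq_one finite_E in auto)

lemma klein_swap23: "klein_action G E \<phi> \<alpha> \<gamma> \<beta>"
  by unfold_locales (use carrier_eq distinct4 square_eq_one finite_E in auto)

lemma mem_carrier: "\<alpha> \<in> carrier G" "\<beta> \<in> carrier G" "\<gamma> \<in> carrier G"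
  by (simp_all add: carrier_eq)

lemma mult_12: "\<alpha> \<otimes> \<beta> = \<gamma>"
proof -
  interpret group G
    using group_hom group_hom.axioms(1) by auto
  have "\<alpha> \<otimes> \<beta> \<in> {\<one>, \<alpha>, \<beta>, \<gamma>}"
    using m_closed mem_carrier carrier_eq by blast
  \<comment> \<open>As \<alpha> squares to the identity too, cancelling \<alpha> would give \<beta>
    = \<alpha>.\<close>
  moreover have "\<alpha> \<otimes> \<beta> \<noteq> \<one>"
    using Units_l_cancel[of \<alpha> \<beta> \<alpha>] mem_carrier distinct4 square_eq_one by auto
  moreover have "\<alpha> \<otimes> \<beta> \<noteq> \<alpha>" "\<alpha> \<otimes> \<beta> \<noteq> \<beta>"
    using mem_carrier distinct4 by auto
  ultimately show ?thesis by auto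
qed

lemma act_one: "x \<in> E \<Longrightarrow> \<phi> \<one> x = x"
  by (metis id_eq_one restrict_apply')

text \<open>The six mixed products are \<open>mult_12\<close> read under the six orderings of the
  involutions; commutativity comes out of this.\<close>

lemma act_mult:
  assumes "x \<in> E"
  shows "\<phi> \<alpha> (\<phi> \<alpha> x) = x" "\<phi> \<beta> (\<phi> \<beta> x) = x" "\<phi> \<gamma> (\<phi> \<gamma> x) = x"
    "\<phi> \<alpha> (\<phi> \<beta> x) = \<phi> \<gamma> x" "\<phi> \<beta> (\<phi> \<alpha> x) = \<phi> \<gamma> x"
    "\<phi> \<alpha> (\<phi> \<gamma> x) = \<phi> \<beta> x" "\<phi> \<gamma> (\<phi> \<alpha> x) = \<phi> \<beta> x"
    "\<phi> \<beta> (\<phi> \<gamma> x) = \<phi> \<alpha> x" "\<phi> \<gamma> (\<phi> \<beta> x) = \<phi> \<alpha> x"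
proof -
  interpret s12: klein_action G E \<phi> \<beta> \<alpha> \<gamma> by (rule klein_swap12)
  interpret s13: klein_action G E \<phi> \<gamma> \<beta> \<alpha> by (rule klein_swap13)
  interpret s23: klein_action G E \<phi> \<alpha> \<gamma> \<beta> by (rule klein_swap23)
  interpret s123: klein_action G E \<phi> \<beta> \<gamma> \<alpha> by (rule s12.klein_swap23)
  interpret s132: klein_action G E \<phi> \<gamma> \<alpha> \<beta> by (rule s13.klein_swap23)
  show "\<phi> \<alpha> (\<phi> \<alpha> x) = x" "\<phi> \<beta> (\<phi> \<beta> x) = x" "\<phi> \<gamma> (\<phi> \<gamma> x) = x"
    "\<phi> \<alpha> (\<phi> \<beta> x) = \<phi> \<gamma> x" "\<phi> \<beta> (\<phi> \<alpha> x) = \<phi> \<gamma> x"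
    "\<phi> \<alpha> (\<phi> \<gamma> x) = \<phi> \<beta> x" "\<phi> \<gamma> (\<phi> \<alpha> x) = \<phi> \<beta> x"
    "\<phi> \<beta> (\<phi> \<gamma> x) = \<phi> \<alpha> x" "\<phi> \<gamma> (\<phi> \<beta> x) = \<phi> \<alpha> x"
    using assms mem_carrier square_eq_one act_one mult_12 s12.mult_12 s13.mult_12 s23.mult_12
      s123.mult_12 s132.mult_12
    by (simp_all flip: composition_rule)
qed

lemma orbit_eq: "x \<in> E \<Longrightarrow> orbit G \<phi> x = {x, \<phi> \<alpha> x, \<phi> \<beta> x, \<phi> \<gamma> x}"
  unfolding orbit_def carrier_eq using act_one[of x, symmetric] by auto

lemma orbit_of_mem:
  assumes "Y \<in> orbits G E \<phi>" "y \<in> Y"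
  shows "y \<in> E" "orbit G \<phi> y = Y"
proof -
  show "y \<in> E" using assms orbits_coverture by blast
  then have "orbit G \<phi> y \<in> orbits G E \<phi>" "y \<in> orbit G \<phi> y"
    using orbit_refl by (auto simp: orbits_def)
  then show "orbit G \<phi> y = Y"
    using disjoint_union[OF _ assms(1), of "orbit G \<phi> y"] assms(2) by blast
qed

lemma act_mem_orbit:
  assumes "Y \<in> orbits G E \<phi>" "y \<in> Y" "\<delta> \<in> carrier G"
  shows "\<phi> \<delta> y \<in> Y"
  using orbit_of_mem[OF assms(1,2)] assms(3) unfolding orbit_def by blast

lemma orbitE:
  assumes "Y \<in> orbits G E \<phi>"
  obtains x where "x \<in> E" "Y = {x, \<phi> \<alpha> x, \<phi> \<beta> x, \<phi> \<gamma> x}"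
  using assms orbit_eq unfolding orbits_def by blast

lemma finite_orbit: "Y \<in> orbits G E \<phi> \<Longrightarrow> finite Y"
  using orbits_coverture finite_E by (metis Union_upper finite_subset)

lemma finite_orbits: "finite (orbits G E \<phi>)"
  using finite_E unfolding orbits_def by simp

lemma sum_Union_orbits:
  fixes f :: "'c \<Rightarrow> nat"
  assumes "\<Y> \<subseteq> orbits G E \<phi>"
  shows "(\<Sum>w\<in>\<Union>\<Y>. f w) = (\<Sum>Y\<in>\<Y>. \<Sum>w\<in>Y. f w)"
proof -
  have "\<forall>A\<in>\<Y>. finite A" "\<forall>A\<in>\<Y>. \<forall>B\<in>\<Y>. A \<noteq> B \<longrightarrow> A \<inter> B = {}"
    using assms finite_orbit disjoint_union by blast+
  then show ?thesis by (simp add: sum.Union_disjoint)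
qed

section \<open>The triples of derivative weights attainable on an orbit\<close>

definition profiles :: "'c set \<Rightarrow> (nat \<times> nat \<times> nat) set" where
  "profiles Y = {(deriv_weight \<phi> g \<alpha> Y, deriv_weight \<phi> g \<beta> Y, deriv_weight \<phi> g \<gamma> Y) | g. True}"

text \<open>Orbits are disjoint and invariant, so a function may be chosen on each one
  independently, and only its weight triple there matters. An arbitrary family of orbits is allowed,
  which covers both the whole set and the set without its 4-orbits.\<close>

lemma ex_perfect_nonlinear_iff_profiles:
  assumes "\<Y> \<subseteq> orbits G E \<phi>"
  shows "(\<exists>g. perfect_nonlinear G \<phi> (\<Union>\<Y>) g) \<longleftrightarrow>
    (\<exists>f. (\<forall>Y\<in>\<Y>. f Y \<in> profiles Y) \<and>
       2 * (\<Sum>Y\<in>\<Y>. fst (f Y)) = (\<Sum>Y\<in>\<Y>. card Y) \<and>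
       2 * (\<Sum>Y\<in>\<Y>. fst (snd (f Y))) = (\<Sum>Y\<in>\<Y>. card Y) \<and>
       2 * (\<Sum>Y\<in>\<Y>. snd (snd (f Y))) = (\<Sum>Y\<in>\<Y>. card Y))"
    (is "?L \<longleftrightarrow> ?R")
proof -
  have fin: "finite (\<Union>\<Y>)"
    using assms finite_E orbits_coverture by (metis Union_mono finite_subset)
  have fY: "finite Y" if "Y \<in> \<Y>" for Y using that assms finite_orbit by blast
  have card: "card (\<Union>\<Y>) = (\<Sum>Y\<in>\<Y>. card Y)"
    using sum_Union_orbits[OF assms, of "\<lambda>_. 1"] by simp
  have dw: "deriv_weight \<phi> g \<delta> (\<Union>\<Y>) = (\<Sum>Y\<in>\<Y>. deriv_weight \<phi> g \<delta> Y)" for g \<delta>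
    unfolding deriv_weight_eq_sum[OF fin] sum_Union_orbits[OF assms]
    using fY by (intro sum.cong refl) (simp add: deriv_weight_eq_sum del: sum_of_bool_eq)
  have G: "carrier G - {\<one>} = {\<alpha>, \<beta>, \<gamma>}"
    using carrier_eq distinct4 by auto
  have PN: "perfect_nonlinear G \<phi> (\<Union>\<Y>) g \<longleftrightarrow>
      2 * (\<Sum>Y\<in>\<Y>. deriv_weight \<phi> g \<alpha> Y) = (\<Sum>Y\<in>\<Y>. card Y) \<and>
      2 * (\<Sum>Y\<in>\<Y>. deriv_weight \<phi> g \<beta> Y) = (\<Sum>Y\<in>\<Y>. card Y) \<and>
      2 * (\<Sum>Y\<in>\<Y>. deriv_weight \<phi> g \<gamma> Y) = (\<Sum>Y\<in>\<Y>. card Y)" for g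
    \<comment> \<open>The parity condition is absorbed: each equation already exhibits the
      cardinality as a double.\<close>
    unfolding perfect_nonlinear_iff_deriv_weight[OF fin] G dw card
    by (metis dvd_triv_left insert_iff empty_iff)
  show ?thesis
  proof
    assume ?L
    then obtain g where "perfect_nonlinear G \<phi> (\<Union>\<Y>) g" ..
    then show ?R unfolding PN
      by (intro exI[of _ "\<lambda>Y. (deriv_weight \<phi> g \<alpha> Y, deriv_weight \<phi> g \<beta> Y, deriv_weight \<phi> g \<gamma> Y)"])
        (auto simp: profiles_def)
  next
    assume ?R
    then obtain f where f: "\<forall>Y\<in>\<Y>. f Y \<in> profiles Y"
      "2 * (\<Sum>Y\<in>\<Y>. fst (f Y)) = (\<Sum>Y\<in>\<Y>. card Y)"
      "2 * (\<Sum>Y\<in>\<Y>. fst (snd (f Y))) = (\<Sum>Y\<in>\<Y>. card Y)"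
      "2 * (\<Sum>Y\<in>\<Y>. snd (snd (f Y))) = (\<Sum>Y\<in>\<Y>. card Y)" by blast
    from f(1) have "\<forall>Y\<in>\<Y>. \<exists>h. f Y =
        (deriv_weight \<phi> h \<alpha> Y, deriv_weight \<phi> h \<beta> Y, deriv_weight \<phi> h \<gamma> Y)"
      by (auto simp: profiles_def)
    then obtain h where h: "\<And>Y. Y \<in> \<Y> \<Longrightarrow> f Y =
        (deriv_weight \<phi> (h Y) \<alpha> Y, deriv_weight \<phi> (h Y) \<beta> Y, deriv_weight \<phi> (h Y) \<gamma> Y)"
      by metis
    \<comment> \<open>Gluing: each point uses the function chosen for its own orbit. Since \<delta>
      keeps a point in its orbit, the derivative of \<open>g\<close> on \<open>Y\<close> is that of
      \<open>h Y\<close>.\<close>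
    define g where "g w = h (orbit G \<phi> w) w" for w
    have "deriv_weight \<phi> g \<delta> Y = deriv_weight \<phi> (h Y) \<delta> Y"
      if "Y \<in> \<Y>" "\<delta> \<in> carrier G" for Y \<delta>
    proof -
      have Y: "Y \<in> orbits G E \<phi>" using that assms by blast
      have "{w \<in> Y. g (\<phi> \<delta> w) \<noteq> g w} = {w \<in> Y. h Y (\<phi> \<delta> w) \<noteq> h Y w}"
        using orbit_of_mem(2)[OF Y] act_mem_orbit[OF Y _ that(2)] by (auto simp: g_def)
      then show ?thesis by (simp add: deriv_weight_def)
    qed
    then have "perfect_nonlinear G \<phi> (\<Union>\<Y>) g"
      unfolding PN using f(2-4) h mem_carrier by simp
    then show ?L by blast
  qed
qed

text \<open>Each involution splits the orbit into two pairs, and a pair on which \<open>g\<close>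
  differs contributes 2. Constant functions give zero, odd weight gives \<open>(2,2,2)\<close>, and
  weight two on \<open>{x, \<phi> \<delta> x}\<close> or its complement gives 0 in direction
  \<delta> and 4 in the other two.\<close>

lemma profiles_card_4:
  assumes "Y \<in> orbits G E \<phi>" "card Y = 4"
  shows "profiles Y = {(0,0,0), (2,2,2), (0,4,4), (4,0,4), (4,4,0)}"
proof -
  obtain x where x: "x \<in> E" and Y: "Y = {x, \<phi> \<alpha> x, \<phi> \<beta> x, \<phi> \<gamma> x}"
    using assms(1) by (rule orbitE)
  have d: "distinct [x, \<phi> \<alpha> x, \<phi> \<beta> x, \<phi> \<gamma> x]"
    using assms(2) unfolding Y by (intro card_distinct) simp
  \<comment> \<open>The reversed list supplies the same inequalities with their sides exchanged, for
    rewriting.\<close>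
  then have d': "distinct [\<phi> \<gamma> x, \<phi> \<beta> x, \<phi> \<alpha> x, x]"
    by auto
  let ?w = "\<lambda>b. of_bool b :: nat"
  have dw: "deriv_weight \<phi> g \<alpha> Y = 2 * ?w (g (\<phi> \<alpha> x) \<noteq> g x) + 2 * ?w (g (\<phi> \<gamma> x) \<noteq> g (\<phi> \<beta> x))"
    "deriv_weight \<phi> g \<beta> Y = 2 * ?w (g (\<phi> \<beta> x) \<noteq> g x) + 2 * ?w (g (\<phi> \<gamma> x) \<noteq> g (\<phi> \<alpha> x))"
    "deriv_weight \<phi> g \<gamma> Y = 2 * ?w (g (\<phi> \<gamma> x) \<noteq> g x) + 2 * ?w (g (\<phi> \<beta> x) \<noteq> g (\<phi> \<alpha> x))" for g
    unfolding deriv_weight_eq_sum[OF finite_orbit[OF assms(1)]] unfolding Y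
    using d by (simp_all add: act_mult[OF x] eq_commute del: sum_of_bool_eq)
  have mem: "(deriv_weight \<phi> g \<alpha> Y, deriv_weight \<phi> g \<beta> Y, deriv_weight \<phi> g \<gamma> Y) \<in> profiles Y" for g
    by (auto simp: profiles_def)
  show ?thesis
  proof
    show "profiles Y \<subseteq> {(0,0,0), (2,2,2), (0,4,4), (4,0,4), (4,4,0)}"
    proof
      fix u assume "u \<in> profiles Y"
      then obtain g where u:
        "u = (deriv_weight \<phi> g \<alpha> Y, deriv_weight \<phi> g \<beta> Y, deriv_weight \<phi> g \<gamma> Y)"
        by (auto simp: profiles_def)
      show "u \<in> {(0,0,0), (2,2,2), (0,4,4), (4,0,4), (4,4,0)}"
        unfolding u dw
        by (cases "g x"; cases "g (\<phi> \<alpha> x)"; cases "g (\<phi> \<beta> x)"; cases "g (\<phi> \<gamma> x)") simp_all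
    qed
    show "{(0,0,0), (2,2,2), (0,4,4), (4,0,4), (4,4,0)} \<subseteq> profiles Y"
      \<comment> \<open>The five witnesses realise the five triples in the order listed.\<close>
      using mem[of "\<lambda>_. 0"] mem[of "\<lambda>w. of_bool (w = x)"]
        mem[of "\<lambda>w. of_bool (w \<in> {x, \<phi> \<alpha> x})"] mem[of "\<lambda>w. of_bool (w \<in> {x, \<phi> \<beta> x})"]
        mem[of "\<lambda>w. of_bool (w \<in> {x, \<phi> \<gamma> x})"] d d'
      unfolding dw by simp
  qed
qed

text \<open>While \<alpha> fixes both points, \<beta> and \<gamma> both exchange them, so their
  weights agree.\<close>

lemma profiles_card_2:
  assumes "Y \<in> orbits G E \<phi>" "card Y = 2" "acts_trivially_on \<phi> \<alpha> Y"
  shows "profiles Y = {(0,0,0), (0,2,2)}"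
proof -
  obtain x where x: "x \<in> E" and "Y = {x, \<phi> \<alpha> x, \<phi> \<beta> x, \<phi> \<gamma> x}"
    using assms(1) by (rule orbitE)
  moreover from this assms(3) have fx: "\<phi> \<alpha> x = x" "\<phi> \<alpha> (\<phi> \<beta> x) = \<phi> \<beta> x"
    by (auto simp: acts_trivially_on_def)
  ultimately have Y: "Y = {x, \<phi> \<beta> x}" and c: "\<phi> \<gamma> x = \<phi> \<beta> x" "\<phi> \<gamma> (\<phi> \<beta> x) = x"
    using act_mult[OF x] by auto
  have d: "\<phi> \<beta> x \<noteq> x"
    using assms(2) unfolding Y by auto
  let ?w = "\<lambda>b. of_bool b :: nat"
  have dw: "deriv_weight \<phi> g \<alpha> Y = 0"
    "deriv_weight \<phi> g \<beta> Y = 2 * ?w (g (\<phi> \<beta> x) \<noteq> g x)"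
    "deriv_weight \<phi> g \<gamma> Y = 2 * ?w (g (\<phi> \<beta> x) \<noteq> g x)" for g
    unfolding deriv_weight_eq_sum[OF finite_orbit[OF assms(1)]] unfolding Y
    using d by (simp_all add: act_mult(2)[OF x] c fx eq_commute del: sum_of_bool_eq)
  have mem: "(deriv_weight \<phi> g \<alpha> Y, deriv_weight \<phi> g \<beta> Y, deriv_weight \<phi> g \<gamma> Y) \<in> profiles Y" for g
    by (auto simp: profiles_def)
  show ?thesis
  proof
    show "profiles Y \<subseteq> {(0,0,0), (0,2,2)}"
      by (auto simp: profiles_def dw)
    show "{(0,0,0), (0,2,2)} \<subseteq> profiles Y"
      using mem[of "\<lambda>_. 0"] mem[of "\<lambda>w. of_bool (w = x)"] d unfolding dw by simp
  qed
qed

text \<open>Renaming the involutions permutes the coordinates of a profile, which reduces both cases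
  to \<open>profiles_card_2\<close>.\<close>

lemma profiles_card_2':
  assumes "Y \<in> orbits G E \<phi>" "card Y = 2"
  shows "acts_trivially_on \<phi> \<beta> Y \<Longrightarrow> profiles Y = {(0,0,0), (2,0,2)}"
    and "acts_trivially_on \<phi> \<gamma> Y \<Longrightarrow> profiles Y = {(0,0,0), (2,2,0)}"
proof -
  interpret s12: klein_action G E \<phi> \<beta> \<alpha> \<gamma> by (rule klein_swap12)
  interpret s13: klein_action G E \<phi> \<gamma> \<beta> \<alpha> by (rule klein_swap13)
  have "profiles Y = (\<lambda>(a, b, c). (b, a, c)) ` s12.profiles Y"
    by (auto simp: profiles_def s12.profiles_def image_iff)
  then show "profiles Y = {(0,0,0), (2,0,2)}" if "acts_trivially_on \<phi> \<beta> Y"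
    using s12.profiles_card_2[OF assms that] by simp
  have "profiles Y = (\<lambda>(a, b, c). (c, b, a)) ` s13.profiles Y"
    by (auto simp: profiles_def s13.profiles_def image_iff)
  then show "profiles Y = {(0,0,0), (2,2,0)}" if "acts_trivially_on \<phi> \<gamma> Y"
    using s13.profiles_card_2[OF assms that] by simp
qed

lemma profiles_card_1:
  assumes "Y \<in> orbits G E \<phi>" "card Y = 1"
  shows "profiles Y = {(0,0,0)}"
proof -
  obtain x where Y: "Y = {x}"
    using assms(2) by (auto simp: card_1_singleton_iff)
  then have "deriv_weight \<phi> g \<delta> Y = 0" if "\<delta> \<in> carrier G" for g \<delta>
    using act_mem_orbit[OF assms(1) _ that] by (auto simp: deriv_weight_def)
  then show ?thesis
    using mem_carrier by (auto simp: profiles_def)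
qed

text \<open>The orbit type is the stabiliser of a point, one of the five subgroups of the group. As
  the group is commutative, all points of the orbit share it, so fixing \<open>x\<close> amounts to
  acting trivially on \<open>Y\<close>. The negated conjuncts make the three 2-orbit types
  exclusive.\<close>

lemma orbit_cases:
  assumes "Y \<in> orbits G E \<phi>"
  shows "card Y = 1 \<or> card Y = 4 \<or> card Y = 2 \<and>
    (acts_trivially_on \<phi> \<alpha> Y \<and> \<not> acts_trivially_on \<phi> \<beta> Y \<and> \<not> acts_trivially_on \<phi> \<gamma> Y \<or>
     \<not> acts_trivially_on \<phi> \<alpha> Y \<and> acts_trivially_on \<phi> \<beta> Y \<and> \<not> acts_trivially_on \<phi> \<gamma> Y \<or>
     \<not> acts_trivially_on \<phi> \<alpha> Y \<and> \<not> acts_trivially_on \<phi> \<beta> Y \<and> acts_trivially_on \<phi> \<gamma> Y)"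
proof -
  obtain x where x: "x \<in> E" and Y: "Y = {x, \<phi> \<alpha> x, \<phi> \<beta> x, \<phi> \<gamma> x}"
    using assms(1) by (rule orbitE)
  note m = act_mult[OF x]
  have e: "\<phi> \<beta> x = \<phi> \<gamma> x \<longleftrightarrow> \<phi> \<alpha> x = x" "\<phi> \<alpha> x = \<phi> \<gamma> x \<longleftrightarrow> \<phi> \<beta> x = x"
    "\<phi> \<alpha> x = \<phi> \<beta> x \<longleftrightarrow> \<phi> \<gamma> x = x"
    using m by metis+
  have f: "\<phi> \<alpha> x = x \<Longrightarrow> \<phi> \<beta> x = x \<Longrightarrow> \<phi> \<gamma> x = x" "\<phi> \<alpha> x = x \<Longrightarrow> \<phi> \<gamma> x = x \<Longrightarrow> \<phi> \<beta> x = x"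
    "\<phi> \<beta> x = x \<Longrightarrow> \<phi> \<gamma> x = x \<Longrightarrow> \<phi> \<alpha> x = x"
    using m by metis+
  have t: "acts_trivially_on \<phi> \<alpha> Y \<longleftrightarrow> \<phi> \<alpha> x = x" "acts_trivially_on \<phi> \<beta> Y \<longleftrightarrow> \<phi> \<beta> x = x"
    "acts_trivially_on \<phi> \<gamma> Y \<longleftrightarrow> \<phi> \<gamma> x = x"
    unfolding acts_trivially_on_def Y using m e by auto
  \<comment> \<open>The cases are the stabilisers: the whole group, the subgroups generated by
    \<alpha>, \<beta> and \<gamma>, and the trivial one.\<close>
  consider "\<phi> \<alpha> x = x" "\<phi> \<beta> x = x" "\<phi> \<gamma> x = x"
    | "\<phi> \<alpha> x = x" "\<phi> \<beta> x \<noteq> x" "\<phi> \<gamma> x = \<phi> \<beta> x"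
    | "\<phi> \<alpha> x \<noteq> x" "\<phi> \<beta> x = x" "\<phi> \<gamma> x = \<phi> \<alpha> x"
    | "\<phi> \<alpha> x \<noteq> x" "\<phi> \<beta> x = \<phi> \<alpha> x" "\<phi> \<gamma> x = x"
    | "distinct [x, \<phi> \<alpha> x, \<phi> \<beta> x, \<phi> \<gamma> x]"
    using e f unfolding distinct.simps list.set insert_iff empty_iff by metis
  then show ?thesis
  proof cases
    case 5
    then have "card Y = 4"
      unfolding Y using distinct_card[OF 5] by simp
    then show ?thesis by simp
  qed (use t in \<open>simp_all add: Y card_insert_if\<close>)
qed

section \<open>Counting orbits by type and profile\<close>

abbreviation "\<O>\<^sub>4 \<equiv> orbits_of_length G E \<phi> 4"
abbreviation "\<O>\<^sub>1 \<equiv> orbits_of_length G E \<phi> 1"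
abbreviation "\<O>\<^sub>2 \<delta> \<equiv> {Y \<in> orbits_of_length G E \<phi> 2. acts_trivially_on \<phi> \<delta> Y}"

lemma orbits_split: "orbits G E \<phi> = \<O>\<^sub>4 \<union> (\<O>\<^sub>2 \<alpha> \<union> (\<O>\<^sub>2 \<beta> \<union> (\<O>\<^sub>2 \<gamma> \<union> \<O>\<^sub>1)))"
proof (rule subset_antisym; rule subsetI)
  fix Y assume Y: "Y \<in> orbits G E \<phi>"
  then show "Y \<in> \<O>\<^sub>4 \<union> (\<O>\<^sub>2 \<alpha> \<union> (\<O>\<^sub>2 \<beta> \<union> (\<O>\<^sub>2 \<gamma> \<union> \<O>\<^sub>1)))"
    using orbit_cases[OF Y] unfolding orbits_of_length_def by (simp, blast)
qed (auto simp: orbits_of_length_def)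

lemma finite_orbit_classes: "finite \<O>\<^sub>4" "finite (\<O>\<^sub>2 \<delta>)" "finite \<O>\<^sub>1"
  using finite_orbits unfolding orbits_of_length_def by simp_all

text \<open>The equations follow the nesting of the union in \<open>orbits_split\<close>, so that
  \<open>sum.union_disjoint\<close> peels off one class at a time.\<close>

lemma disjoint_orbit_classes:
  "\<O>\<^sub>4 \<inter> (\<O>\<^sub>2 \<alpha> \<union> (\<O>\<^sub>2 \<beta> \<union> (\<O>\<^sub>2 \<gamma> \<union> \<O>\<^sub>1))) = {}" "\<O>\<^sub>2 \<alpha> \<inter> (\<O>\<^sub>2 \<beta> \<union> (\<O>\<^sub>2 \<gamma> \<union> \<O>\<^sub>1)) = {}"
  "\<O>\<^sub>2 \<beta> \<inter> (\<O>\<^sub>2 \<gamma> \<union> \<O>\<^sub>1) = {}" "\<O>\<^sub>2 \<gamma> \<inter> \<O>\<^sub>1 = {}"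
proof -
  have "\<O>\<^sub>2 \<alpha> \<inter> \<O>\<^sub>2 \<beta> = {}" "\<O>\<^sub>2 \<alpha> \<inter> \<O>\<^sub>2 \<gamma> = {}" "\<O>\<^sub>2 \<beta> \<inter> \<O>\<^sub>2 \<gamma> = {}"
    unfolding orbits_of_length_def by (auto dest!: orbit_cases)
  moreover have "\<O>\<^sub>4 \<inter> \<O>\<^sub>1 = {}" "\<O>\<^sub>4 \<inter> \<O>\<^sub>2 \<delta> = {}" "\<O>\<^sub>2 \<delta> \<inter> \<O>\<^sub>1 = {}" for \<delta>
    unfolding orbits_of_length_def by auto
  ultimately show "\<O>\<^sub>4 \<inter> (\<O>\<^sub>2 \<alpha> \<union> (\<O>\<^sub>2 \<beta> \<union> (\<O>\<^sub>2 \<gamma> \<union> \<O>\<^sub>1))) = {}"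
    "\<O>\<^sub>2 \<alpha> \<inter> (\<O>\<^sub>2 \<beta> \<union> (\<O>\<^sub>2 \<gamma> \<union> \<O>\<^sub>1)) = {}"
    "\<O>\<^sub>2 \<beta> \<inter> (\<O>\<^sub>2 \<gamma> \<union> \<O>\<^sub>1) = {}" "\<O>\<^sub>2 \<gamma> \<inter> \<O>\<^sub>1 = {}"
    unfolding Int_Un_distrib by (simp_all only: Un_empty simp_thms)
qed

lemma sum_orbits_split:
  fixes h :: "'c set \<Rightarrow> nat"
  shows "sum h (orbits G E \<phi>) =
    sum h \<O>\<^sub>4 + sum h (\<O>\<^sub>2 \<alpha>) + sum h (\<O>\<^sub>2 \<beta>) + sum h (\<O>\<^sub>2 \<gamma>) + sum h \<O>\<^sub>1"
  unfolding orbits_split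
  by (simp only: sum.union_disjoint finite_orbit_classes finite_UnI disjoint_orbit_classes add.assoc)

lemma profiles_of_classes:
  "Y \<in> \<O>\<^sub>4 \<Longrightarrow> profiles Y = {(0,0,0), (2,2,2), (0,4,4), (4,0,4), (4,4,0)}"
  "Y \<in> \<O>\<^sub>2 \<alpha> \<Longrightarrow> profiles Y = {(0,0,0), (0,2,2)}"
  "Y \<in> \<O>\<^sub>2 \<beta> \<Longrightarrow> profiles Y = {(0,0,0), (2,0,2)}"
  "Y \<in> \<O>\<^sub>2 \<gamma> \<Longrightarrow> profiles Y = {(0,0,0), (2,2,0)}"
  "Y \<in> \<O>\<^sub>1 \<Longrightarrow> profiles Y = {(0,0,0)}"
  unfolding orbits_of_length_def
  by (simp_all only: mem_Collect_eq profiles_card_4 profiles_card_2 profiles_card_2' profiles_card_1)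

text \<open>Only the number of orbits of each type carrying each profile matters. Here
  \<open>k, n, a, b, c\<close> count the 4-orbits with profiles \<open>(0,0,0)\<close>,
  \<open>(2,2,2)\<close>, \<open>(0,4,4)\<close>, \<open>(4,0,4)\<close>, \<open>(4,4,0)\<close>,
  and \<open>p\<^sub>1, q\<^sub>1, r\<^sub>1\<close> count the 2-orbits with nonzero
  profile.\<close>

lemma ex_perfect_nonlinear_iff_counts:
  "(\<exists>g. perfect_nonlinear G \<phi> E g) \<longleftrightarrow>
    (\<exists>k n a b c p\<^sub>1 q\<^sub>1 r\<^sub>1. k + n + a + b + c = card \<O>\<^sub>4 \<and>
      p\<^sub>1 \<le> card (\<O>\<^sub>2 \<alpha>) \<and> q\<^sub>1 \<le> card (\<O>\<^sub>2 \<beta>) \<and> r\<^sub>1 \<le> card (\<O>\<^sub>2 \<gamma>) \<and>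
      2 * (2 * n + 4 * b + 4 * c + 2 * q\<^sub>1 + 2 * r\<^sub>1) = (\<Sum>Y\<in>orbits G E \<phi>. card Y) \<and>
      2 * (2 * n + 4 * a + 4 * c + 2 * p\<^sub>1 + 2 * r\<^sub>1) = (\<Sum>Y\<in>orbits G E \<phi>. card Y) \<and>
      2 * (2 * n + 4 * a + 4 * b + 2 * p\<^sub>1 + 2 * q\<^sub>1) = (\<Sum>Y\<in>orbits G E \<phi>. card Y))"
    (is "?L \<longleftrightarrow> ?R")
proof -
  let ?N = "\<Sum>Y\<in>orbits G E \<phi>. card Y"
  let ?T4 = "{(0,0,0), (2,2,2), (0,4,4), (4,0,4), (4,4,0)} :: (nat \<times> nat \<times> nat) set"
  let ?Ta = "{(0,0,0), (0,2,2)} :: (nat \<times> nat \<times> nat) set"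
  let ?Tb = "{(0,0,0), (2,0,2)} :: (nat \<times> nat \<times> nat) set"
  let ?Tc = "{(0,0,0), (2,2,0)} :: (nat \<times> nat \<times> nat) set"
  have fin: "finite ?T4" "finite ?Ta" "finite ?Tb" "finite ?Tc" by simp_all
  have L: "?L \<longleftrightarrow> (\<exists>f. (\<forall>Y\<in>orbits G E \<phi>. f Y \<in> profiles Y) \<and>
       2 * (\<Sum>Y\<in>orbits G E \<phi>. fst (f Y)) = ?N \<and>
       2 * (\<Sum>Y\<in>orbits G E \<phi>. fst (snd (f Y))) = ?N \<and>
       2 * (\<Sum>Y\<in>orbits G E \<phi>. snd (snd (f Y))) = ?N)"
    using ex_perfect_nonlinear_iff_profiles[OF subset_refl] unfolding orbits_coverture .
  have ball_profiles: "(\<forall>Y\<in>\<Y>. f Y \<in> profiles Y) \<longleftrightarrow> f ` \<Y> \<subseteq> T"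
    if "\<And>Y. Y \<in> \<Y> \<Longrightarrow> profiles Y = T" for f \<Y> T
    using that by auto
  have prof: "(\<forall>Y\<in>orbits G E \<phi>. f Y \<in> profiles Y) \<longleftrightarrow> f ` \<O>\<^sub>4 \<subseteq> ?T4 \<and> f ` \<O>\<^sub>2 \<alpha> \<subseteq> ?Ta \<and>
      f ` \<O>\<^sub>2 \<beta> \<subseteq> ?Tb \<and> f ` \<O>\<^sub>2 \<gamma> \<subseteq> ?Tc \<and> f ` \<O>\<^sub>1 \<subseteq> {(0,0,0)}" for f
    unfolding orbits_split ball_Un
    by (intro arg_cong2[where f = "(\<and>)"] ball_profiles profiles_of_classes)
  show ?thesis
  proof
    assume ?L
    then obtain f where fp: "\<forall>Y\<in>orbits G E \<phi>. f Y \<in> profiles Y" and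
      f: "2 * (\<Sum>Y\<in>orbits G E \<phi>. fst (f Y)) = ?N"
       "2 * (\<Sum>Y\<in>orbits G E \<phi>. fst (snd (f Y))) = ?N"
       "2 * (\<Sum>Y\<in>orbits G E \<phi>. snd (snd (f Y))) = ?N"
      unfolding L by blast
    have im: "f ` \<O>\<^sub>4 \<subseteq> ?T4" "f ` \<O>\<^sub>2 \<alpha> \<subseteq> ?Ta" "f ` \<O>\<^sub>2 \<beta> \<subseteq> ?Tb" "f ` \<O>\<^sub>2 \<gamma> \<subseteq> ?Tc"
        "f ` \<O>\<^sub>1 \<subseteq> {(0,0,0)}"
      using fp unfolding prof by (simp_all only: simp_thms)
    obtain m4 where m4: "(\<Sum>k\<in>?T4. m4 k) = card \<O>\<^sub>4"
      "\<forall>h :: _ \<Rightarrow> nat. (\<Sum>Y\<in>\<O>\<^sub>4. h (f Y)) = (\<Sum>k\<in>?T4. m4 k * h k)"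
      using ex_fibre_sums_of_map[OF fin(1) finite_orbit_classes(1) im(1)]
      by (elim exE conjE) (rule that)
    obtain ma where ma: "(\<Sum>k\<in>?Ta. ma k) = card (\<O>\<^sub>2 \<alpha>)"
      "\<forall>h :: _ \<Rightarrow> nat. (\<Sum>Y\<in>\<O>\<^sub>2 \<alpha>. h (f Y)) = (\<Sum>k\<in>?Ta. ma k * h k)"
      using ex_fibre_sums_of_map[OF fin(2) finite_orbit_classes(2) im(2)]
      by (elim exE conjE) (rule that)
    obtain mb where mb: "(\<Sum>k\<in>?Tb. mb k) = card (\<O>\<^sub>2 \<beta>)"
      "\<forall>h :: _ \<Rightarrow> nat. (\<Sum>Y\<in>\<O>\<^sub>2 \<beta>. h (f Y)) = (\<Sum>k\<in>?Tb. mb k * h k)"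
      using ex_fibre_sums_of_map[OF fin(3) finite_orbit_classes(2) im(3)]
      by (elim exE conjE) (rule that)
    obtain mc where mc: "(\<Sum>k\<in>?Tc. mc k) = card (\<O>\<^sub>2 \<gamma>)"
      "\<forall>h :: _ \<Rightarrow> nat. (\<Sum>Y\<in>\<O>\<^sub>2 \<gamma>. h (f Y)) = (\<Sum>k\<in>?Tc. mc k * h k)"
      using ex_fibre_sums_of_map[OF fin(4) finite_orbit_classes(2) im(4)]
      by (elim exE conjE) (rule that)
    \<comment> \<open>With \<open>h\<close> vanishing at the zero profile, the 1-orbits and all
      orbits on which the profile is zero drop out. The three coordinate projections are such
      \<open>h\<close>.\<close>
    have sum: "(\<Sum>Y\<in>orbits G E \<phi>. h (f Y)) =
        m4 (2,2,2) * h (2,2,2) + m4 (0,4,4) * h (0,4,4) + m4 (4,0,4) * h (4,0,4) +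
        m4 (4,4,0) * h (4,4,0) + ma (0,2,2) * h (0,2,2) + mb (2,0,2) * h (2,0,2) +
        mc (2,2,0) * h (2,2,0)"
      if h0: "h (0,0,0) = 0" for h :: "nat \<times> nat \<times> nat \<Rightarrow> nat"
    proof -
      have "(\<Sum>Y\<in>\<O>\<^sub>1. h (f Y)) = 0"
        using im(5) h0 by (intro sum.neutral ballI) (simp add: image_subset_iff)
      then show ?thesis
        unfolding sum_orbits_split m4(2)[rule_format] ma(2)[rule_format] mb(2)[rule_format]
          mc(2)[rule_format]
        by (simp add: h0)
    qed
    have card4: "m4 (0,0,0) + m4 (2,2,2) + m4 (0,4,4) + m4 (4,0,4) + m4 (4,4,0) = card \<O>\<^sub>4"
      unfolding m4(1)[symmetric] by simp
    have le: "ma (0,2,2) \<le> card (\<O>\<^sub>2 \<alpha>)" "mb (2,0,2) \<le> card (\<O>\<^sub>2 \<beta>)" "mc (2,2,0) \<le> card (\<O>\<^sub>2 \<gamma>)"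
      unfolding ma(1)[symmetric] mb(1)[symmetric] mc(1)[symmetric] by simp_all
    have N1: "2 * (2 * m4 (2,2,2) + 4 * m4 (4,0,4) + 4 * m4 (4,4,0) + 2 * mb (2,0,2) + 2 * mc (2,2,0)) = ?N"
      unfolding f(1)[symmetric] using sum[of fst] by simp
    have N2: "2 * (2 * m4 (2,2,2) + 4 * m4 (0,4,4) + 4 * m4 (4,4,0) + 2 * ma (0,2,2) + 2 * mc (2,2,0)) = ?N"
      unfolding f(2)[symmetric] using sum[of "\<lambda>k. fst (snd k)"] by simp
    have N3: "2 * (2 * m4 (2,2,2) + 4 * m4 (0,4,4) + 4 * m4 (4,0,4) + 2 * ma (0,2,2) + 2 * mb (2,0,2)) = ?N"
      unfolding f(3)[symmetric] using sum[of "\<lambda>k. snd (snd k)"] by simp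
    show ?R
      using card4 le N1 N2 N3 by (intro exI conjI)
  next
    assume ?R
    then obtain k n a b c p\<^sub>1 q\<^sub>1 r\<^sub>1 where
      le: "p\<^sub>1 \<le> card (\<O>\<^sub>2 \<alpha>)" "q\<^sub>1 \<le> card (\<O>\<^sub>2 \<beta>)" "r\<^sub>1 \<le> card (\<O>\<^sub>2 \<gamma>)" and
      eqs: "k + n + a + b + c = card \<O>\<^sub>4"
        "2 * (2 * n + 4 * b + 4 * c + 2 * q\<^sub>1 + 2 * r\<^sub>1) = ?N"
        "2 * (2 * n + 4 * a + 4 * c + 2 * p\<^sub>1 + 2 * r\<^sub>1) = ?N"
        "2 * (2 * n + 4 * a + 4 * b + 2 * p\<^sub>1 + 2 * q\<^sub>1) = ?N"
      by (elim exE conjE) (rule that)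
    define m4 :: "nat \<times> nat \<times> nat \<Rightarrow> nat" where
      "m4 = (\<lambda>_. 0)((0,0,0) := k, (2,2,2) := n, (0,4,4) := a, (4,0,4) := b, (4,4,0) := c)"
    \<comment> \<open>Each type of 2-orbit has a single nonzero profile, so one default value
      \<open>j\<close> serves all three types; the remaining \<open>l - j\<close> orbits get the
      zero profile.\<close>
    define m2 :: "nat \<Rightarrow> nat \<Rightarrow> nat \<times> nat \<times> nat \<Rightarrow> nat" where
      "m2 = (\<lambda>j l. (\<lambda>_. j)((0,0,0) := l - j))"
    have m4: "(\<Sum>k\<in>?T4. m4 k) = card \<O>\<^sub>4"
      unfolding eqs(1)[symmetric] by (simp add: m4_def)
    have m2: "(\<Sum>k\<in>?Ta. m2 p\<^sub>1 (card (\<O>\<^sub>2 \<alpha>)) k) = card (\<O>\<^sub>2 \<alpha>)"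
      "(\<Sum>k\<in>?Tb. m2 q\<^sub>1 (card (\<O>\<^sub>2 \<beta>)) k) = card (\<O>\<^sub>2 \<beta>)"
      "(\<Sum>k\<in>?Tc. m2 r\<^sub>1 (card (\<O>\<^sub>2 \<gamma>)) k) = card (\<O>\<^sub>2 \<gamma>)"
      using le by (simp_all add: m2_def)
    obtain f4 where f4: "f4 ` \<O>\<^sub>4 \<subseteq> ?T4"
      "\<forall>h :: _ \<Rightarrow> nat. (\<Sum>Y\<in>\<O>\<^sub>4. h (f4 Y)) = (\<Sum>k\<in>?T4. m4 k * h k)"
      using ex_map_with_fibre_sums[OF fin(1) finite_orbit_classes(1) m4]
      by (elim exE conjE) (rule that)
    obtain fa where fa: "fa ` \<O>\<^sub>2 \<alpha> \<subseteq> ?Ta"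
      "\<forall>h :: _ \<Rightarrow> nat. (\<Sum>Y\<in>\<O>\<^sub>2 \<alpha>. h (fa Y)) = (\<Sum>k\<in>?Ta. m2 p\<^sub>1 (card (\<O>\<^sub>2 \<alpha>)) k * h k)"
      using ex_map_with_fibre_sums[OF fin(2) finite_orbit_classes(2) m2(1)]
      by (elim exE conjE) (rule that)
    obtain fb where fb: "fb ` \<O>\<^sub>2 \<beta> \<subseteq> ?Tb"
      "\<forall>h :: _ \<Rightarrow> nat. (\<Sum>Y\<in>\<O>\<^sub>2 \<beta>. h (fb Y)) = (\<Sum>k\<in>?Tb. m2 q\<^sub>1 (card (\<O>\<^sub>2 \<beta>)) k * h k)"
      using ex_map_with_fibre_sums[OF fin(3) finite_orbit_classes(2) m2(2)]
      by (elim exE conjE) (rule that)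
    obtain fc where fc: "fc ` \<O>\<^sub>2 \<gamma> \<subseteq> ?Tc"
      "\<forall>h :: _ \<Rightarrow> nat. (\<Sum>Y\<in>\<O>\<^sub>2 \<gamma>. h (fc Y)) = (\<Sum>k\<in>?Tc. m2 r\<^sub>1 (card (\<O>\<^sub>2 \<gamma>)) k * h k)"
      using ex_map_with_fibre_sums[OF fin(4) finite_orbit_classes(2) m2(3)]
      by (elim exE conjE) (rule that)
    \<comment> \<open>The final default is the only profile of a 1-orbit; disjointness of the
      classes makes every branch take effect on its whole class.\<close>
    define f where "f Y = (if Y \<in> \<O>\<^sub>4 then f4 Y else if Y \<in> \<O>\<^sub>2 \<alpha> then fa Y else
      if Y \<in> \<O>\<^sub>2 \<beta> then fb Y else if Y \<in> \<O>\<^sub>2 \<gamma> then fc Y else (0,0,0))" for Y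
    have restr: "f Y = f4 Y" if "Y \<in> \<O>\<^sub>4" for Y
      unfolding f_def using that by (rule if_P)
    have restr_a: "f Y = fa Y" if "Y \<in> \<O>\<^sub>2 \<alpha>" for Y
    proof -
      have "Y \<notin> \<O>\<^sub>4" using that disjoint_orbit_classes by blast
      then show ?thesis using that unfolding f_def by (simp only: if_True if_False)
    qed
    have restr_b: "f Y = fb Y" if "Y \<in> \<O>\<^sub>2 \<beta>" for Y
    proof -
      have "Y \<notin> \<O>\<^sub>4" "Y \<notin> \<O>\<^sub>2 \<alpha>" using that disjoint_orbit_classes by blast+
      then show ?thesis using that unfolding f_def by (simp only: if_True if_False)
    qed
    have restr_c: "f Y = fc Y" if "Y \<in> \<O>\<^sub>2 \<gamma>" for Y
    proof -
      have "Y \<notin> \<O>\<^sub>4" "Y \<notin> \<O>\<^sub>2 \<alpha>" "Y \<notin> \<O>\<^sub>2 \<beta>" using that disjoint_orbit_classes by blast+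
      then show ?thesis using that unfolding f_def by (simp only: if_True if_False)
    qed
    have restr_1: "f Y = (0,0,0)" if "Y \<in> \<O>\<^sub>1" for Y
    proof -
      have "Y \<notin> \<O>\<^sub>4" "Y \<notin> \<O>\<^sub>2 \<alpha>" "Y \<notin> \<O>\<^sub>2 \<beta>" "Y \<notin> \<O>\<^sub>2 \<gamma>"
        using that disjoint_orbit_classes by blast+
      then show ?thesis unfolding f_def by (simp only: if_False)
    qed
    have "f ` \<O>\<^sub>4 = f4 ` \<O>\<^sub>4" "f ` \<O>\<^sub>2 \<alpha> = fa ` \<O>\<^sub>2 \<alpha>" "f ` \<O>\<^sub>2 \<beta> = fb ` \<O>\<^sub>2 \<beta>" "f ` \<O>\<^sub>2 \<gamma> = fc ` \<O>\<^sub>2 \<gamma>"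
      by (intro image_cong refl restr restr_a restr_b restr_c; assumption)+
    moreover have "f ` \<O>\<^sub>1 \<subseteq> {(0,0,0)}"
      unfolding image_subset_iff singleton_iff using restr_1 by (rule ballI)
    ultimately have "\<forall>Y\<in>orbits G E \<phi>. f Y \<in> profiles Y"
      unfolding prof using f4(1) fa(1) fb(1) fc(1) by (simp only: simp_thms)
    moreover have sum: "(\<Sum>Y\<in>orbits G E \<phi>. h (f Y)) =
        n * h (2,2,2) + a * h (0,4,4) + b * h (4,0,4) + c * h (4,4,0) +
        p\<^sub>1 * h (0,2,2) + q\<^sub>1 * h (2,0,2) + r\<^sub>1 * h (2,2,0)"
      if h0: "h (0,0,0) = 0" for h :: "nat \<times> nat \<times> nat \<Rightarrow> nat"
    proof -
      have "(\<Sum>Y\<in>\<O>\<^sub>4. h (f Y)) = (\<Sum>Y\<in>\<O>\<^sub>4. h (f4 Y))"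
        "(\<Sum>Y\<in>\<O>\<^sub>2 \<alpha>. h (f Y)) = (\<Sum>Y\<in>\<O>\<^sub>2 \<alpha>. h (fa Y))"
        "(\<Sum>Y\<in>\<O>\<^sub>2 \<beta>. h (f Y)) = (\<Sum>Y\<in>\<O>\<^sub>2 \<beta>. h (fb Y))"
        "(\<Sum>Y\<in>\<O>\<^sub>2 \<gamma>. h (f Y)) = (\<Sum>Y\<in>\<O>\<^sub>2 \<gamma>. h (fc Y))"
        by (intro sum.cong refl arg_cong[where f = h] restr restr_a restr_b restr_c; assumption)+
      moreover have "(\<Sum>Y\<in>\<O>\<^sub>1. h (f Y)) = 0"
        using h0 by (intro sum.neutral ballI) (simp only: restr_1)
      ultimately show ?thesis
        unfolding sum_orbits_split
        by (simp add: f4(2)[rule_format] fa(2)[rule_format] fb(2)[rule_format] fc(2)[rule_format]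
            h0 m4_def m2_def)
    qed
    have "2 * (\<Sum>Y\<in>orbits G E \<phi>. fst (f Y)) = ?N"
      unfolding eqs(2)[symmetric] using sum[of fst] by simp
    moreover have "2 * (\<Sum>Y\<in>orbits G E \<phi>. fst (snd (f Y))) = ?N"
      unfolding eqs(3)[symmetric] using sum[of "\<lambda>k. fst (snd k)"] by simp
    moreover have "2 * (\<Sum>Y\<in>orbits G E \<phi>. snd (snd (f Y))) = ?N"
      unfolding eqs(4)[symmetric] using sum[of "\<lambda>k. snd (snd k)"] by simp
    ultimately show ?L
      unfolding L by (intro exI[of _ f] conjI)
  qed
qed

text \<open>The bracket is the number \<open>v\<^sub>0\<close> of points outside the
  4-orbits.\<close>

lemma sum_card_orbits:
  "(\<Sum>Y\<in>orbits G E \<phi>. card Y) =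
    4 * card \<O>\<^sub>4 + (2 * card (\<O>\<^sub>2 \<alpha>) + 2 * card (\<O>\<^sub>2 \<beta>) + 2 * card (\<O>\<^sub>2 \<gamma>) + card \<O>\<^sub>1)"
proof -
  have "sum card \<O>\<^sub>4 = 4 * card \<O>\<^sub>4" "sum card (\<O>\<^sub>2 \<delta>) = 2 * card (\<O>\<^sub>2 \<delta>)"
    "sum card \<O>\<^sub>1 = card \<O>\<^sub>1" for \<delta>
    by (simp_all add: orbits_of_length_def)
  then show ?thesis unfolding sum_orbits_split by simp
qed

text \<open>The profile \<open>(2,2,2)\<close> contributes half of a 4-orbit in every direction, so
  giving it to all 4-orbits preserves the three balances.\<close>

lemma ex_perfect_nonlinear_extend:
  assumes "\<exists>g. perfect_nonlinear G \<phi> (E - \<Union> \<O>\<^sub>4) g"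
  shows "\<exists>g. perfect_nonlinear G \<phi> E g"
proof -
  let ?\<O> = "orbits G E \<phi>" and ?\<Y> = "orbits G E \<phi> - \<O>\<^sub>4"
  have sub: "\<O>\<^sub>4 \<subseteq> ?\<O>" by (auto simp: orbits_of_length_def)
  have "E - \<Union> \<O>\<^sub>4 = \<Union> ?\<Y>"
    using orbits_coverture disjoint_union sub by blast
  then obtain f where f: "\<forall>Y\<in>?\<Y>. f Y \<in> profiles Y"
      "2 * (\<Sum>Y\<in>?\<Y>. fst (f Y)) = (\<Sum>Y\<in>?\<Y>. card Y)"
      "2 * (\<Sum>Y\<in>?\<Y>. fst (snd (f Y))) = (\<Sum>Y\<in>?\<Y>. card Y)"
      "2 * (\<Sum>Y\<in>?\<Y>. snd (snd (f Y))) = (\<Sum>Y\<in>?\<Y>. card Y)"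
    using assms ex_perfect_nonlinear_iff_profiles[of ?\<Y>] by auto
  define f' where "f' Y = (if Y \<in> \<O>\<^sub>4 then (2,2,2) else f Y)" for Y
  have sums: "2 * (\<Sum>Y\<in>?\<O>. h (f' Y)) = (\<Sum>Y\<in>?\<O>. card Y)"
    if "2 * (\<Sum>Y\<in>?\<Y>. h (f Y)) = (\<Sum>Y\<in>?\<Y>. card Y)" "h (2,2,2) = 2" for h
  proof -
    have "(\<Sum>Y\<in>?\<Y>. h (f' Y)) = (\<Sum>Y\<in>?\<Y>. h (f Y))"
      by (intro sum.cong) (auto simp: f'_def)
    moreover have "(\<Sum>Y\<in>\<O>\<^sub>4. h (f' Y)) = 2 * card \<O>\<^sub>4" "(\<Sum>Y\<in>\<O>\<^sub>4. card Y) = 4 * card \<O>\<^sub>4"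
      using that(2) by (simp_all add: f'_def orbits_of_length_def)
    ultimately show ?thesis
      unfolding sum.subset_diff[OF sub finite_orbits] using that(1) by simp
  qed
  have "\<forall>Y\<in>?\<O>. f' Y \<in> profiles Y"
    using f(1) profiles_of_classes(1) by (auto simp: f'_def)
  moreover have "2 * (\<Sum>Y\<in>?\<O>. fst (f' Y)) = (\<Sum>Y\<in>?\<O>. card Y)"
    using f(2) by (rule sums) simp
  moreover have "2 * (\<Sum>Y\<in>?\<O>. fst (snd (f' Y))) = (\<Sum>Y\<in>?\<O>. card Y)"
    using f(3) by (rule sums) simp
  moreover have "2 * (\<Sum>Y\<in>?\<O>. snd (snd (f' Y))) = (\<Sum>Y\<in>?\<O>. card Y)"
    using f(4) by (rule sums) simp
  ultimately have "\<exists>g. perfect_nonlinear G \<phi> (\<Union>?\<O>) g"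
    unfolding ex_perfect_nonlinear_iff_profiles[OF subset_refl] by (intro exI[of _ f'] conjI)
  then show ?thesis
    unfolding orbits_coverture .
qed

end

section \<open>Transport of structure from the product of two cyclic groups of order 2\<close>

lemma klein_four_group_facts:
  assumes "klein_four_group G"
  shows "group G" "card (carrier G) = 4" "\<And>\<delta>. \<delta> \<in> carrier G \<Longrightarrow> \<delta> \<otimes>\<^bsub>G\<^esub> \<delta> = \<one>\<^bsub>G\<^esub>"
proof -
  let ?H = "integer_mod_group 2 \<times>\<times> integer_mod_group 2"
  show G: "group G" using assms by (simp add: klein_four_group_def)
  interpret G: group G by (rule G)
  obtain h where h: "h \<in> iso G ?H"
    using assms by (auto simp: klein_four_group_def is_iso_def)
  have H: "group ?H" by (simp add: DirProd_group)
  have bij: "bij_betw h (carrier G) (carrier ?H)"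
    using h by (simp add: iso_def)
  then show "card (carrier G) = 4"
    by (simp add: bij_betw_same_card carrier_integer_mod_group)
  have hom: "h \<in> hom G ?H" using h by (simp add: iso_def)
  fix \<delta> assume d: "\<delta> \<in> carrier G"
  have "u \<otimes>\<^bsub>?H\<^esub> u = \<one>\<^bsub>?H\<^esub>" for u
    by (cases u) (simp add: DirProd_def)
  then have "h (\<delta> \<otimes>\<^bsub>G\<^esub> \<delta>) = h \<one>\<^bsub>G\<^esub>"
    using hom_mult[OF hom d d] hom_one[OF hom G H] by simp
  then show "\<delta> \<otimes>\<^bsub>G\<^esub> \<delta> = \<one>\<^bsub>G\<^esub>"
    using bij d by (auto simp: bij_betw_def inj_on_eq_iff)
qed

section \<open>Solving the linear system in natural numbers\<close>

lemma Max3_le_iff: "Max {x, y, z} \<le> u \<longleftrightarrow> x \<le> u \<and> y \<le> u \<and> z \<le> u" for u :: "'a :: linorder"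
  by simp

text \<open>Solving for \<open>a, b, c\<close> and then \<open>n\<close>, the \<open>Max\<close>
  bound says that \<open>a, b, c\<close> are nonnegative, the bound on \<open>s\<close> says that
  \<open>n\<close> is, and the congruences together with \<open>4 dvd v\<close> make the solution
  integral.\<close>

lemma klein_count_solution_iff:
  fixes s p q r v :: nat
  shows "(\<exists>k n a b c p\<^sub>1 q\<^sub>1 r\<^sub>1. k + n + a + b + c = s \<and> p\<^sub>1 \<le> p \<and> q\<^sub>1 \<le> q \<and> r\<^sub>1 \<le> r \<and>
      2 * (2 * n + 4 * b + 4 * c + 2 * q\<^sub>1 + 2 * r\<^sub>1) = 4 * s + v \<and>
      2 * (2 * n + 4 * a + 4 * c + 2 * p\<^sub>1 + 2 * r\<^sub>1) = 4 * s + v \<and>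
      2 * (2 * n + 4 * a + 4 * b + 2 * p\<^sub>1 + 2 * q\<^sub>1) = 4 * s + v) \<longleftrightarrow>
    4 dvd v \<and>
     (\<exists>k p\<^sub>1 q\<^sub>1 r\<^sub>1 :: nat.
        p\<^sub>1 \<le> p \<and> q\<^sub>1 \<le> q \<and> r\<^sub>1 \<le> r \<and> [p\<^sub>1 = q\<^sub>1] (mod 2) \<and> [q\<^sub>1 = r\<^sub>1] (mod 2) \<and>
        real s \<ge> 3 * real v / 4 + 4 * real k - 2 * (real p\<^sub>1 + real q\<^sub>1 + real r\<^sub>1) \<and>
        real v / 4 + real k \<ge>
          Max {real p\<^sub>1 + (real q\<^sub>1 + real r\<^sub>1) / 2,
               real q\<^sub>1 + (real p\<^sub>1 + real r\<^sub>1) / 2,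
               real r\<^sub>1 + (real p\<^sub>1 + real q\<^sub>1) / 2})" (is "?L \<longleftrightarrow> ?R")
proof
  assume ?L
  then obtain k n a b c p\<^sub>1 q\<^sub>1 r\<^sub>1 where
    le: "p\<^sub>1 \<le> p" "q\<^sub>1 \<le> q" "r\<^sub>1 \<le> r" and
    eqs: "k + n + a + b + c = s"
      "2 * (2 * n + 4 * b + 4 * c + 2 * q\<^sub>1 + 2 * r\<^sub>1) = 4 * s + v"
      "2 * (2 * n + 4 * a + 4 * c + 2 * p\<^sub>1 + 2 * r\<^sub>1) = 4 * s + v"
      "2 * (2 * n + 4 * a + 4 * b + 2 * p\<^sub>1 + 2 * q\<^sub>1) = 4 * s + v"
    by blast
  \<comment> \<open>Substituting for \<open>s\<close> cancels \<open>n\<close>; divisibility of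
    \<open>v\<close> by 4 can then be read off.\<close>
  have v_eq: "v + 4 * (k + a) = 4 * (b + c + q\<^sub>1 + r\<^sub>1)"
    using eqs(1,2) by simp
  \<comment> \<open>Differences of the equations yield the congruences modulo 2.\<close>
  have ab: "2 * b + q\<^sub>1 = 2 * a + p\<^sub>1"
    using eqs(2,3) by simp
  have bc: "2 * c + r\<^sub>1 = 2 * b + q\<^sub>1"
    using eqs(3,4) by simp
  have reals: "real s = real k + real n + real a + real b + real c"
    "real v + 4 * real k + 4 * real a = 4 * real b + 4 * real c + 4 * real q\<^sub>1 + 4 * real r\<^sub>1"
    "2 * real b + real q\<^sub>1 = 2 * real a + real p\<^sub>1" "2 * real c + real r\<^sub>1 = 2 * real b + real q\<^sub>1"
    using eqs(1)[THEN arg_cong[of _ _ real]] v_eq[THEN arg_cong[of _ _ real]]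
      ab[THEN arg_cong[of _ _ real]] bc[THEN arg_cong[of _ _ real]] by auto
  have "4 dvd v"
    using v_eq by (metis dvd_add_left_iff dvd_triv_left)
  moreover have "[p\<^sub>1 = q\<^sub>1] (mod 2)" "[q\<^sub>1 = r\<^sub>1] (mod 2)"
    unfolding cong_def using ab bc by presburger+
  moreover have "real s \<ge> 3 * real v / 4 + 4 * real k - 2 * (real p\<^sub>1 + real q\<^sub>1 + real r\<^sub>1)"
    using reals of_nat_0_le_iff[of n] by (simp add: field_simps)
  moreover have "real v / 4 + real k \<ge> Max {real p\<^sub>1 + (real q\<^sub>1 + real r\<^sub>1) / 2,
       real q\<^sub>1 + (real p\<^sub>1 + real r\<^sub>1) / 2, real r\<^sub>1 + (real p\<^sub>1 + real q\<^sub>1) / 2}"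
    unfolding Max3_le_iff using reals of_nat_0_le_iff[of a] of_nat_0_le_iff[of b]
      of_nat_0_le_iff[of c] by (simp add: field_simps)
  ultimately show ?R using le by blast
next
  assume ?R
  then obtain k p\<^sub>1 q\<^sub>1 r\<^sub>1 where "4 dvd v" and le: "p\<^sub>1 \<le> p" "q\<^sub>1 \<le> q" "r\<^sub>1 \<le> r" and
    par: "[p\<^sub>1 = q\<^sub>1] (mod 2)" "[q\<^sub>1 = r\<^sub>1] (mod 2)" and
    s: "real s \<ge> 3 * real v / 4 + 4 * real k - 2 * (real p\<^sub>1 + real q\<^sub>1 + real r\<^sub>1)" and
    m: "real v / 4 + real k \<ge> Max {real p\<^sub>1 + (real q\<^sub>1 + real r\<^sub>1) / 2,
       real q\<^sub>1 + (real p\<^sub>1 + real r\<^sub>1) / 2, real r\<^sub>1 + (real p\<^sub>1 + real q\<^sub>1) / 2}"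
    by blast
  obtain V where V: "v = 4 * V" using \<open>4 dvd v\<close> by blast
  have "even (q\<^sub>1 + r\<^sub>1)" "even (p\<^sub>1 + r\<^sub>1)" "even (p\<^sub>1 + q\<^sub>1)"
    using par unfolding cong_def by presburger+
  \<comment> \<open>These are the half sums in the \<open>Max\<close> bound, integral by the parity
    condition.\<close>
  then obtain x y z where xyz: "q\<^sub>1 + r\<^sub>1 = 2 * x" "p\<^sub>1 + r\<^sub>1 = 2 * y" "p\<^sub>1 + q\<^sub>1 = 2 * z"
    by (meson evenE)
  have xyz': "real q\<^sub>1 + real r\<^sub>1 = 2 * real x" "real p\<^sub>1 + real r\<^sub>1 = 2 * real y"
    "real p\<^sub>1 + real q\<^sub>1 = 2 * real z"
    using xyz[THEN arg_cong[of _ _ real]] by simp_all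
  have "real (p\<^sub>1 + x) \<le> real (V + k)" "real (q\<^sub>1 + y) \<le> real (V + k)" "real (r\<^sub>1 + z) \<le> real (V + k)"
    using m unfolding V Max3_le_iff xyz' by simp_all
  then have "p\<^sub>1 + x \<le> V + k" "q\<^sub>1 + y \<le> V + k" "r\<^sub>1 + z \<le> V + k"
    by (simp_all only: of_nat_le_iff)
  \<comment> \<open>The numbers \<open>a, b, c\<close> are the slacks in the three bounds;
    \<open>n\<close> will be the slack in the bound on \<open>s\<close>.\<close>
  then obtain a b c where abc: "V + k = p\<^sub>1 + x + a" "V + k = q\<^sub>1 + y + b" "V + k = r\<^sub>1 + z + c"
    by (metis le_iff_add)
  have abc': "real V + real k = real p\<^sub>1 + real x + real a"
    "real V + real k = real q\<^sub>1 + real y + real b" "real V + real k = real r\<^sub>1 + real z + real c"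
    using abc[THEN arg_cong[of _ _ real]] by simp_all
  have "3 * real V + 4 * real k - 2 * real p\<^sub>1 - 2 * real q\<^sub>1 - 2 * real r\<^sub>1 \<le> real s"
    using s unfolding V by simp
  then have "real (k + a + b + c) \<le> real s"
    unfolding of_nat_add using xyz' abc' by linarith
  then have "k + a + b + c \<le> s"
    by (simp only: of_nat_le_iff)
  then obtain n where n: "s = k + a + b + c + n" by (metis le_iff_add)
  \<comment> \<open>These are the three required equations after cancelling \<open>n\<close> and
    dividing by 4.\<close>
  have "real (b + c + q\<^sub>1 + r\<^sub>1) = real (V + k + a)" "real (a + c + p\<^sub>1 + r\<^sub>1) = real (V + k + b)"
    "real (a + b + p\<^sub>1 + q\<^sub>1) = real (V + k + c)"
    unfolding of_nat_add using xyz' abc' by - linarith+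
  then have e: "b + c + q\<^sub>1 + r\<^sub>1 = V + k + a" "a + c + p\<^sub>1 + r\<^sub>1 = V + k + b" "a + b + p\<^sub>1 + q\<^sub>1 = V + k + c"
    by (simp_all only: of_nat_eq_iff)
  have "2 * (2 * n + 4 * b + 4 * c + 2 * q\<^sub>1 + 2 * r\<^sub>1) = 4 * s + v"
    unfolding n V using e(1) by simp
  moreover have "2 * (2 * n + 4 * a + 4 * c + 2 * p\<^sub>1 + 2 * r\<^sub>1) = 4 * s + v"
    unfolding n V using e(2) by simp
  moreover have "2 * (2 * n + 4 * a + 4 * b + 2 * p\<^sub>1 + 2 * q\<^sub>1) = 4 * s + v"
    unfolding n V using e(3) by simp
  moreover have "k + n + a + b + c = s"
    unfolding n by simp
  ultimately show ?L
    using le by (intro exI conjI)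
qed

theorem theorem5p8:
  fixes G :: "('g, 'm) monoid_scheme"
    and \<phi> :: "'g \<Rightarrow> 'x \<Rightarrow> 'x"
    and X :: "'x set"
    and \<alpha> \<beta> \<gamma> :: 'g
    and s p q r t v\<^sub>0 :: nat
  assumes "klein_four_group G"
    and "carrier G = {\<one>\<^bsub>G\<^esub>, \<alpha>, \<beta>, \<gamma>}"
    and "group_action G X \<phi>"
    and "finite X"
    and "s = card (orbits_of_length G X \<phi> 4)"
    and "p = card {Y \<in> orbits_of_length G X \<phi> 2. acts_trivially_on \<phi> \<alpha> Y}"
    and "q = card {Y \<in> orbits_of_length G X \<phi> 2. acts_trivially_on \<phi> \<beta> Y}"
    and "r = card {Y \<in> orbits_of_length G X \<phi> 2. acts_trivially_on \<phi> \<gamma> Y}"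
    and "t = card (orbits_of_length G X \<phi> 1)"
    and "v\<^sub>0 = 2 * p + 2 * q + 2 * r + t"
  shows "(\<exists>g. perfect_nonlinear G \<phi> X g) \<longleftrightarrow>
    (\<exists>g. perfect_nonlinear G \<phi> (X - \<Union> (orbits_of_length G X \<phi> 4)) g) \<or>
    (4 dvd v\<^sub>0 \<and>
     (\<exists>k\<^sub>0 p\<^sub>1 q\<^sub>1 r\<^sub>1 :: nat.
        p\<^sub>1 \<le> p \<and> q\<^sub>1 \<le> q \<and> r\<^sub>1 \<le> r \<and>
        [p\<^sub>1 = q\<^sub>1] (mod 2) \<and> [q\<^sub>1 = r\<^sub>1] (mod 2) \<and>
        real s \<ge> 3 * real v\<^sub>0 / 4 + 4 * real k\<^sub>0 - 2 * (real p\<^sub>1 + real q\<^sub>1 + real r\<^sub>1) \<and>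
        real v\<^sub>0 / 4 + real k\<^sub>0 \<ge>
          Max {real p\<^sub>1 + (real q\<^sub>1 + real r\<^sub>1) / 2,
               real q\<^sub>1 + (real p\<^sub>1 + real r\<^sub>1) / 2,
               real r\<^sub>1 + (real p\<^sub>1 + real q\<^sub>1) / 2}))"
proof -
  note K = klein_four_group_facts[OF assms(1)]
  interpret group_action G X \<phi> by (rule assms(3))
  \<comment> \<open>A list of four entries whose set has four elements cannot repeat an
    entry.\<close>
  have "distinct [\<one>\<^bsub>G\<^esub>, \<alpha>, \<beta>, \<gamma>]"
    using K(2) unfolding assms(2) by (intro card_distinct) simp
  then interpret klein_action G X \<phi> \<alpha> \<beta> \<gamma>
    using assms(2,4) K(3) by unfold_locales auto
  \<comment> \<open>Existence on \<open>X\<close> is equivalent to the counting condition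
    \<open>C\<close> and hence to (ii), while (i) enters by its implication.\<close>
  have glue: "P \<longleftrightarrow> A \<or> B" if "P \<longleftrightarrow> C" "C \<longleftrightarrow> B" "A \<Longrightarrow> P" for P A B C
    using that by blast
  show ?thesis
    using ex_perfect_nonlinear_iff_counts klein_count_solution_iff[of s p q r v\<^sub>0]
    unfolding sum_card_orbits assms(5-9)[symmetric] assms(10)[symmetric]
    by (rule glue) (rule ex_perfect_nonlinear_extend)
qed

end
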